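(* There is a function $f:\mathbb{Q}\to\{0,1,2,3\}$ such that for every $x\in\mathbb{Q}$ the set $S_x=\{h\in\mathbb{Q}: h>0,\ f(x-h)=f(x+h)\}$ is finite. *)

theory Defs
  imports Complex_Main
begin

end

theory Submission
  imports Defs
begin

text \<open>
  Write $\mathbb{Q}$ as the increasing union of the cyclic groups $G_m = \frac{1}{m!}\mathbb{Z}$ and
  colour $a \in G_m \setminus G_{m-1}$ by its sign and by the parity of $\lfloor a (m-1)! \rfloor$.
  If $x \in G_n$ and $a \notin G_n$, then $a$ and $2x - a$ first appear in the same $G_m$ with
  $m > n$, and $a (m-1)!$ is a non-integer $t$ which reflection in $x$ sends to $2j - t$ with $j$ an
  integer; so the parity of the floor changes. Two points symmetric about $x$ at distance more than
  $|x|$ from it have opposite signs. Hence equal colours at $x \pm h$ force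
  $h \in G_n \cap [0, |x|]$, a finite set.
\<close>

definition level :: "rat \<Rightarrow> nat"
  where "level a = (LEAST m. a * fact m \<in> \<int>)"

text \<open>For an integer \<open>a\<close> the level is 0 and truncated subtraction leaves the
  factor \<open>fact 0\<close>; the parity is compared only at points of level above
  \<open>level x\<close>, hence positive.\<close>

definition floor_parity :: "rat \<Rightarrow> bool"
  where "floor_parity a = even \<lfloor>a * fact (level a - 1)\<rfloor>"

lemma mult_fact_Ints_mono:
  fixes a :: "'a :: field_char_0"
  assumes "a * fact m \<in> \<int>" "m \<le> n"
  shows "a * fact n \<in> \<int>"
proof -
  obtain k :: nat where "fact n = fact m * k"
    using fact_dvd[OF assms(2), where 'a = nat] by (auto elim: dvdE)
  then have "(fact n :: 'a) = fact m * of_nat k"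
    by (metis of_nat_fact of_nat_mult)
  then have "a * fact n = (a * fact m) * of_nat k"
    by simp
  then show ?thesis
    using assms(1) by (metis Ints_mult Ints_of_nat)
qed

text \<open>The denominator \<open>q\<close> divides \<open>fact q\<close>, so the
  \<open>LEAST\<close> in \<open>level\<close> ranges over a nonempty set.\<close>

lemma mult_fact_level_Ints: "a * fact (level a) \<in> \<int>"
proof -
  obtain p q where a: "a = of_int p / of_int q" "q > 0"
    by (cases a) (auto simp: Fract_of_int_quotient)
  have "nat q dvd fact (nat q)"
    using a(2) by (intro dvd_fact) auto
  then obtain k where "fact (nat q) = nat q * k"
    by (elim dvdE)
  then have "(fact (nat q) :: rat) = of_int q * of_nat k"
    using a(2) by (metis of_nat_fact of_nat_mult of_nat_nat less_imp_le)
  then have "a * fact (nat q) = of_int (p * int k)"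
    using a by simp
  then have "a * fact (nat q) \<in> \<int>"
    by (metis Ints_of_int)
  then show ?thesis
    unfolding level_def by (rule LeastI)
qed

lemma mult_fact_Ints_iff: "a * fact m \<in> \<int> \<longleftrightarrow> level a \<le> m"
  using mult_fact_level_Ints mult_fact_Ints_mono
  by (metis level_def Least_le)

text \<open>Once \<open>level x \<le> m\<close>, reflection in \<open>x\<close> maps the group of
  all \<open>a\<close> with \<open>a * fact m \<in> \<int>\<close> to itself.\<close>

lemma level_reflect:
  assumes "level x < level a"
  shows "level (2 * x - a) = level a"
proof -
  have "(2 * x - a) * fact m \<in> \<int> \<longleftrightarrow> a * fact m \<in> \<int>" if "level x \<le> m" for m
  proof -
    have x: "2 * (x * fact m) \<in> \<int>"
      using that by (simp add: mult_fact_Ints_iff)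
    have "(2 * x - a) * fact m = 2 * (x * fact m) - a * fact m"
      by (simp add: algebra_simps)
    then show ?thesis
      \<comment> \<open>Reflection is an involution, so the same closure under differences gives
        both directions.\<close>
      using x Ints_diff[OF x, of "a * fact m"] Ints_diff[OF x, of "2 * (x * fact m) - a * fact m"]
      by auto
  qed
  then have *: "level (2 * x - a) \<le> m \<longleftrightarrow> level a \<le> m" if "level x \<le> m" for m
    using that by (simp add: mult_fact_Ints_iff)
  show ?thesis
    using assms *[of "level a"] *[of "level a - 1"] *[of "level (2 * x - a)"] by linarith
qed

text \<open>As \<open>t\<close> lies strictly between consecutive integers, so does its reflection;
  the two floors have an odd sum, hence opposite parities.\<close>

lemma floor_even_minus_nonint:
  fixes t :: "'a :: floor_ceiling"
  assumes "t \<notin> \<int>"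
  shows "\<lfloor>2 * of_int j - t\<rfloor> = 2 * j - 1 - \<lfloor>t\<rfloor>"
proof -
  have "of_int \<lfloor>t\<rfloor> \<noteq> t"
    using assms by (metis Ints_of_int)
  then have "of_int \<lfloor>t\<rfloor> < t" "t < of_int \<lfloor>t\<rfloor> + 1"
    using of_int_floor_le[of t] floor_less_iff[of t "\<lfloor>t\<rfloor> + 1"] by (auto simp: order_less_le)
  then show ?thesis
    by (intro floor_unique) auto
qed

lemma floor_parity_reflect:
  assumes "level x < level a"
  shows "floor_parity (2 * x - a) \<longleftrightarrow> \<not> floor_parity a"
proof -
  \<comment> \<open>The last level at which \<open>a\<close> is still non-integral, while
    \<open>x\<close> is already integral there.\<close>
  define m where "m = level a - 1"
  have m: "level x \<le> m" "\<not> level a \<le> m"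
    using assms by (auto simp: m_def)
  obtain j where j: "x * fact m = of_int j"
    using m(1) by (metis mult_fact_Ints_iff Ints_cases)
  have "a * fact m \<notin> \<int>"
    using m(2) by (simp add: mult_fact_Ints_iff)
  then have "\<lfloor>2 * of_int j - a * fact m\<rfloor> = 2 * j - 1 - \<lfloor>a * fact m\<rfloor>"
    by (rule floor_even_minus_nonint)
  moreover have "(2 * x - a) * fact m = 2 * of_int j - a * fact m"
    by (simp add: algebra_simps flip: j)
  ultimately show ?thesis
    unfolding floor_parity_def level_reflect[OF assms] m_def[symmetric] by simp
qed

lemma finite_bounded_mult_Ints:
  fixes c :: "'a :: floor_ceiling"
  assumes "c > 0"
  shows "finite {h. 0 < h \<and> h \<le> b \<and> h * c \<in> \<int>}"
proof (rule finite_subset)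
  show "{h. 0 < h \<and> h \<le> b \<and> h * c \<in> \<int>} \<subseteq> (\<lambda>k. of_int k / c) ` {0..\<lfloor>b * c\<rfloor>}"
  proof clarify
    fix h assume h: "0 < h" "h \<le> b" "h * c \<in> \<int>"
    then obtain k where k: "h * c = of_int k"
      by (auto elim: Ints_cases)
    have "(of_int k :: 'a) \<ge> 0" "of_int k \<le> b * c"
      using h assms by (simp_all flip: k)
    then have "k \<in> {0..\<lfloor>b * c\<rfloor>}"
      by (simp add: le_floor_iff)
    moreover have "h = of_int k / c"
      using assms by (simp flip: k)
    ultimately show "h \<in> (\<lambda>k. of_int k / c) ` {0..\<lfloor>b * c\<rfloor>}"
      by blast
  qed
qed simp

theorem theorem6:
  shows "\<exists>f :: rat \<Rightarrow> nat. range f \<subseteq> {0, 1, 2, 3} \<and>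
           (\<forall>x :: rat. finite {h :: rat. h > 0 \<and> f (x - h) = f (x + h)})"
proof -
  define f :: "rat \<Rightarrow> nat" where
    "f = (\<lambda>a. (if a < 0 then 0 else 2) + (if floor_parity a then 0 else 1))"
  have f_eqD: "(a < 0 \<longleftrightarrow> b < 0) \<and> (floor_parity a \<longleftrightarrow> floor_parity b)" if "f a = f b" for a b
    using that by (auto simp: f_def split: if_splits)
  have "finite {h. h > 0 \<and> f (x - h) = f (x + h)}" for x
  proof (rule finite_subset)
    show "{h. h > 0 \<and> f (x - h) = f (x + h)}
            \<subseteq> {h. 0 < h \<and> h \<le> \<bar>x\<bar> \<and> h * fact (level x) \<in> \<int>}"
    proof clarify
      fix h assume h: "h > 0" and eq: "f (x - h) = f (x + h)"
      have "h \<le> \<bar>x\<bar>"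
        using f_eqD[OF eq] h by linarith
      \<comment> \<open>Otherwise \<open>x + h\<close> and its mirror image
        \<open>2 * x - (x + h) = x - h\<close> would differ in parity.\<close>
      moreover have "level (x + h) \<le> level x"
        using floor_parity_reflect[of x "x + h"] f_eqD[OF eq] by (force simp: algebra_simps)
      then have "(x + h) * fact (level x) - x * fact (level x) \<in> \<int>"
        by (intro Ints_diff) (simp_all add: mult_fact_Ints_iff)
      then have "h * fact (level x) \<in> \<int>"
        by (simp add: algebra_simps)
      ultimately show "h \<le> \<bar>x\<bar> \<and> h * fact (level x) \<in> \<int>"
        by blast
    qed
  qed (rule finite_bounded_mult_Ints, simp)
  moreover have "range f \<subseteq> {0, 1, 2, 3}"
    by (auto simp: f_def split: if_splits)
  ultimately show ?thesis
    by blast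
qed

end
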